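(* Let $\mathbb{F}$ be a field, $X,Y,Z$ finite sets, and $F:X\times Y\times Z\to\mathbb{F}$ unstable. Then for every integer $n\geq1$, \[ \operatorname{slice-rank}(F^{\otimes n})\leq(\lvert X\rvert^n+\lvert Y\rvert^n+\lvert Z\rvert^n)\,e^{-2n\,\operatorname{instability}(F)^2}. \]
   Context: Slice rank of $G:X\times Y\times Z\to\mathbb{F}$: least $k$ with $G(x,y,z)=\sum_{i=1}^a f_i(x,y)g_i(z)+\sum_{i=a+1}^b f_i(x,z)g_i(y)+\sum_{i=b+1}^k f_i(y,z)g_i(x)$. $F^{\otimes n}:X^n\times Y^n\times Z^n\to\mathbb{F}$ is $F^{\otimes n}(\mathbf{x},\mathbf{y},\mathbf{z})=\prod_{i=1}^nF(x_i,y_i,z_i)$. $F$ is unstable if there exist bases $\{f_a\}_{a\in A}$, $\{g_b\}_{b\in B}$, $\{h_c\}_{c\in C}$ of the spaces of functions $X\to\mathbb{F}$, $Y\to\mathbb{F}$, $Z\to\mathbb{F}$, real weights $u_a,v_b,w_c$ with means $u_{\mathrm{avg}},v_{\mathrm{avg}},w_{\mathrm{avg}}$, and coefficients $r_{a,b,c}\in\mathbb{F}$ with $F=\sum_{u_a+v_b+w_c<u_{\mathrm{avg}}+v_{\mathrm{avg}}+w_{\mathrm{avg}}}r_{a,b,c}f_a\otimes g_b\otimes h_c$. The instability of $F$ is the supremum of all $\varepsilon\geq0$ for which there exist such bases, real weights $u_a,v_b,w_c$ that are nontrivial (i.e. $u_{\max}-u_{\min}+v_{\max}-v_{\min}+w_{\max}-w_{\min}>0$),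 and coefficients $r_{a,b,c}$ with $F(x,y,z)=\sum_{u_a+v_b+w_c\leq R}r_{a,b,c}f_a(x)g_b(y)h_c(z)$, where $R=(u_{\mathrm{avg}}+v_{\mathrm{avg}}+w_{\mathrm{avg}})-\varepsilon(u_{\max}-u_{\min}+v_{\max}-v_{\min}+w_{\max}-w_{\min})$; it is $-\infty$ if no such $\varepsilon\ge 0$ exists. *)

theory Defs
  imports "HOL-Analysis.Analysis" "HOL-Library.Function_Algebras"
begin

definition slice_decomposable ::
  "'x set \<Rightarrow> 'y set \<Rightarrow> 'z set \<Rightarrow> ('x \<Rightarrow> 'y \<Rightarrow> 'z \<Rightarrow> 'a::field) \<Rightarrow> nat \<Rightarrow> bool" where
  "slice_decomposable X Y Z G k \<longleftrightarrow>
     (\<exists>a b. a \<le> b \<and> b \<le> k \<and>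
       (\<exists>(f1 :: nat \<Rightarrow> 'x \<Rightarrow> 'y \<Rightarrow> 'a) (g1 :: nat \<Rightarrow> 'z \<Rightarrow> 'a)
         (f2 :: nat \<Rightarrow> 'x \<Rightarrow> 'z \<Rightarrow> 'a) (g2 :: nat \<Rightarrow> 'y \<Rightarrow> 'a)
         (f3 :: nat \<Rightarrow> 'y \<Rightarrow> 'z \<Rightarrow> 'a) (g3 :: nat \<Rightarrow> 'x \<Rightarrow> 'a).
         \<forall>x\<in>X. \<forall>y\<in>Y. \<forall>z\<in>Z.
           G x y z = (\<Sum>i\<in>{1..a}. f1 i x y * g1 i z)
                   + (\<Sum>i\<in>{a+1..b}. f2 i x z * g2 i y)
                   + (\<Sum>i\<in>{b+1..k}. f3 i y z * g3 i x)))"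

definition slice_rank ::
  "'x set \<Rightarrow> 'y set \<Rightarrow> 'z set \<Rightarrow> ('x \<Rightarrow> 'y \<Rightarrow> 'z \<Rightarrow> 'a::field) \<Rightarrow> nat" where
  "slice_rank X Y Z G = (LEAST k. slice_decomposable X Y Z G k)"

(* For finite sets the minimum defining the slice rank is over a nonempty set. *)
lemma slice_decomposable_card:
  assumes "finite X"
  shows "slice_decomposable X Y Z G (card X)"
proof -
  obtain e where e: "bij_betw e {1..card X} X"
    using assms ex_bij_betw_nat_finite_1 by blast
  have "G x y z = (\<Sum>i\<in>{1..card X}. G (e i) y z * (if e i = x then 1 else 0))"
    if "x \<in> X" for x y z
  proof -
    have "(\<Sum>i\<in>{1..card X}. G (e i) y z * (if e i = x then 1 else 0))
        = (\<Sum>x'\<in>X. G x' y z * (if x' = x then 1 else 0))"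
      using e by (rule sum.reindex_bij_betw)
    also have "\<dots> = (\<Sum>x'\<in>X. if x' = x then G x' y z else 0)"
      by (rule sum.cong) auto
    also have "\<dots> = G x y z"
      using assms that by simp
    finally show ?thesis by simp
  qed
  then show ?thesis
    unfolding slice_decomposable_def
    by (intro exI[of _ 0] conjI exI[of _ "\<lambda>_ _ _. 0"] exI[of _ "\<lambda>_ _. 0"]
        exI[of _ "\<lambda>i. G (e i)"] exI[of _ "\<lambda>i x. if e i = x then 1 else 0"]) auto
qed

(* The n-tuples over X are the extensional functions from {..<n} to X. *)
abbreviation tuples :: "nat \<Rightarrow> 'x set \<Rightarrow> (nat \<Rightarrow> 'x) set" where
  "tuples n X \<equiv> {..<n} \<rightarrow>\<^sub>E X"

definition tensor_power ::
  "nat \<Rightarrow> ('x \<Rightarrow> 'y \<Rightarrow> 'z \<Rightarrow> 'a::field) \<Rightarrow>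
   (nat \<Rightarrow> 'x) \<Rightarrow> (nat \<Rightarrow> 'y) \<Rightarrow> (nat \<Rightarrow> 'z) \<Rightarrow> 'a" where
  "tensor_power n F = (\<lambda>x y z. \<Prod>i<n. F (x i) (y i) (z i))"

definition fun_scale :: "'a::field \<Rightarrow> ('x \<Rightarrow> 'a) \<Rightarrow> 'x \<Rightarrow> 'a" where
  "fun_scale c h = (\<lambda>x. c * h x)"

interpretation fun_vs: vector_space fun_scale
  by unfold_locales (auto simp: fun_scale_def fun_eq_iff algebra_simps)

(* Functions from X to the field, represented by their extension by zero outside X. *)
definition fun_space :: "'x set \<Rightarrow> ('x \<Rightarrow> 'a::field) set" where
  "fun_space X = {h. \<forall>x. x \<notin> X \<longrightarrow> h x = 0}"

(* The family f indexed by A is a basis of the space of functions on X.  As X is finite in all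
   applications, so is A, and restricting to indices of type nat loses no generality. *)
definition fun_basis :: "'x set \<Rightarrow> nat set \<Rightarrow> (nat \<Rightarrow> 'x \<Rightarrow> 'a::field) \<Rightarrow> bool" where
  "fun_basis X A f \<longleftrightarrow>
     inj_on f A \<and> fun_vs.independent (f ` A) \<and> fun_vs.span (f ` A) = fun_space X"

definition avg :: "nat set \<Rightarrow> (nat \<Rightarrow> real) \<Rightarrow> real" where
  "avg A u = (\<Sum>a\<in>A. u a) / real (card A)"

definition spread :: "nat set \<Rightarrow> (nat \<Rightarrow> real) \<Rightarrow> real" where
  "spread A u = Max (u ` A) - Min (u ` A)"

definition unstable ::
  "'x set \<Rightarrow> 'y set \<Rightarrow> 'z set \<Rightarrow> ('x \<Rightarrow> 'y \<Rightarrow> 'z \<Rightarrow> 'a::field) \<Rightarrow> bool" where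
  "unstable X Y Z F \<longleftrightarrow>
     (\<exists>A B C (f :: nat \<Rightarrow> 'x \<Rightarrow> 'a) (g :: nat \<Rightarrow> 'y \<Rightarrow> 'a) (h :: nat \<Rightarrow> 'z \<Rightarrow> 'a) u v w r.
        fun_basis X A f \<and> fun_basis Y B g \<and> fun_basis Z C h \<and>
        (\<forall>x\<in>X. \<forall>y\<in>Y. \<forall>z\<in>Z.
           F x y z =
             (\<Sum>(a, b, c) \<in> {(a, b, c) \<in> A \<times> B \<times> C.
                                u a + v b + w c < avg A u + avg B v + avg C w}.
                r a b c * f a x * g b y * h c z)))"

definition instability_witness ::
  "'x set \<Rightarrow> 'y set \<Rightarrow> 'z set \<Rightarrow> ('x \<Rightarrow> 'y \<Rightarrow> 'z \<Rightarrow> 'a::field) \<Rightarrow> real \<Rightarrow> bool" where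
  "instability_witness X Y Z F \<epsilon> \<longleftrightarrow>
     (\<exists>A B C (f :: nat \<Rightarrow> 'x \<Rightarrow> 'a) (g :: nat \<Rightarrow> 'y \<Rightarrow> 'a) (h :: nat \<Rightarrow> 'z \<Rightarrow> 'a) u v w r.
        fun_basis X A f \<and> fun_basis Y B g \<and> fun_basis Z C h \<and>
        spread A u + spread B v + spread C w > 0 \<and>
        (\<forall>x\<in>X. \<forall>y\<in>Y. \<forall>z\<in>Z.
           F x y z =
             (\<Sum>(a, b, c) \<in> {(a, b, c) \<in> A \<times> B \<times> C.
                                u a + v b + w c \<le>
                                  (avg A u + avg B v + avg C w)
                                  - \<epsilon> * (spread A u + spread B v + spread C w)}.
                r a b c * f a x * g b y * h c z)))"

(* The supremum of the empty set in ereal is -\<infinity>.  The supremum can also be \<infinity>: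
   for F = 0 every nonnegative real is a witness as soon as nontrivial weights exist. *)
definition instability ::
  "'x set \<Rightarrow> 'y set \<Rightarrow> 'z set \<Rightarrow> ('x \<Rightarrow> 'y \<Rightarrow> 'z \<Rightarrow> 'a::field) \<Rightarrow> ereal" where
  "instability X Y Z F = Sup {ereal \<epsilon> | \<epsilon>. \<epsilon> \<ge> 0 \<and> instability_witness X Y Z F \<epsilon>}"

definition exp_ereal :: "ereal \<Rightarrow> ereal" where
  "exp_ereal t = (case t of ereal s \<Rightarrow> ereal (exp s) | PInfty \<Rightarrow> \<infinity> | MInfty \<Rightarrow> 0)"

end

theory Submission
  imports Defs "HOL-Probability.Hoeffding"
begin

text \<open>
  Expanding the tensor power in the product bases indexed by tuples, a triple of tuples
  contributes only if its total weight is at most \<open>n\<close> times the threshold. Then one of the three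
  tuples has a weight that lies below its mean by at least \<open>n \<epsilon>\<close> times the spread, and
  by Hoeffding's inequality the proportion of such tuples is at most \<open>exp (- 2 n \<epsilon>\<^sup>2)\<close>.
  Every exceptional tuple costs one slice.
\<close>

section \<open>Bases of function spaces and spreads of weights\<close>

text \<open>The point indicators \<open>e x\<close> for x in \<open>X\<close> span the function
  space, so an independent set inside it is finite and no larger than \<open>X\<close>; injectivity
  of \<open>f\<close> carries this bound from the image back to the index set.\<close>

lemma fun_basis_finite_card_le:
  fixes f :: "nat \<Rightarrow> 'x \<Rightarrow> 'a::field"
  assumes "finite X" and "fun_basis X A f"
  shows "finite A" and "card A \<le> card X"
proof -
  define e :: "'x \<Rightarrow> 'x \<Rightarrow> 'a" where "e = (\<lambda>x y. if x = y then 1 else 0)"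
  have "fun_space X \<subseteq> fun_vs.span (e ` X)"
  proof
    fix h :: "'x \<Rightarrow> 'a"
    assume h: "h \<in> fun_space X"
    have "h = (\<Sum>x\<in>X. fun_scale (h x) (e x))"
    proof
      fix y
      have "(\<Sum>x\<in>X. fun_scale (h x) (e x)) y = (\<Sum>x\<in>X. if x = y then h x else 0)"
        using assms(1) by (induction X rule: finite_induct) (auto simp: fun_scale_def e_def)
      then show "h y = (\<Sum>x\<in>X. fun_scale (h x) (e x)) y"
        using h assms(1) by (auto simp: fun_space_def)
    qed
    also have "\<dots> \<in> fun_vs.span (e ` X)"
      by (intro fun_vs.span_sum fun_vs.span_scale fun_vs.span_base) auto
    finally show "h \<in> fun_vs.span (e ` X)" .
  qed
  moreover have "f ` A \<subseteq> fun_space X"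
    using assms(2) fun_vs.span_superset[of "f ` A"] by (simp add: fun_basis_def)
  ultimately have "f ` A \<subseteq> fun_vs.span (e ` X)"
    by (rule order_trans[rotated])
  then have "finite (f ` A) \<and> card (f ` A) \<le> card (e ` X)"
    using assms fun_vs.independent_span_bound[of "e ` X" "f ` A"]
    by (auto simp: fun_basis_def)
  moreover have "inj_on f A"
    using assms(2) by (simp add: fun_basis_def)
  ultimately show "finite A" and "card A \<le> card X"
    using card_image_le[OF assms(1), of e] by (auto simp: card_image finite_image_iff)
qed

lemma spread_nonneg: "finite A \<Longrightarrow> A \<noteq> {} \<Longrightarrow> spread A u \<ge> 0"
  unfolding spread_def by (metis Max_in Min_le diff_ge_0_iff_ge finite_imageI image_is_empty)

lemma spread_zero_imp_eq_avg:
  assumes "finite A" and "a \<in> A" and "spread A u = 0"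
  shows "u a = avg A u"
proof -
  have "u b = Max (u ` A)" if "b \<in> A" for b
  proof (rule antisym)
    show "u b \<le> Max (u ` A)"
      using assms(1) that by simp
    show "Max (u ` A) \<le> u b"
      using assms(1,3) that by (simp add: spread_def)
  qed
  then have "u b = u a" if "b \<in> A" for b
    using that assms(2) by metis
  then have "(\<Sum>b\<in>A. u b) = real (card A) * u a"
    by simp
  then show ?thesis
    using assms(1,2) by (auto simp: avg_def)
qed

section \<open>Hoeffding bound for the number of light tuples\<close>

text \<open>This is Hoeffding's lemma for the uniform distribution on \<open>A\<close>: the downward
  deviation \<open>avg A u - u a\<close> has mean zero and takes values in an interval of length
  \<open>spread A u\<close>.\<close>

lemma sum_exp_deviation_le:
  assumes "finite A" and "A \<noteq> {}" and "l > 0"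
  shows "(\<Sum>a\<in>A. exp (l * (avg A u - u a))) \<le> real (card A) * exp (l\<^sup>2 * (spread A u)\<^sup>2 / 8)"
proof -
  interpret interval_bounded_random_variable "measure_pmf (pmf_of_set A)" "\<lambda>a. avg A u - u a"
    "avg A u - Max (u ` A)" "avg A u - Min (u ` A)"
  proof unfold_locales
    show "AE a in measure_pmf (pmf_of_set A).
        avg A u - u a \<in> {avg A u - Max (u ` A)..avg A u - Min (u ` A)}"
    proof (rule AE_pmfI)
      fix a assume "a \<in> set_pmf (pmf_of_set A)"
      then have "a \<in> A"
        by (simp only: set_pmf_of_set[OF assms(2,1)])
      with assms(1) show "avg A u - u a \<in> {avg A u - Max (u ` A)..avg A u - Min (u ` A)}"
        by simp
    qed
  qed simp
  have mean: "measure_pmf.expectation (pmf_of_set A) (\<lambda>a. avg A u - u a) = 0"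
    using assms by (simp add: integral_pmf_of_set sum_subtractf avg_def)
  have "(\<integral>\<^sup>+a. ennreal (exp (l * (avg A u - u a))) \<partial>measure_pmf (pmf_of_set A))
      = ennreal ((\<Sum>a\<in>A. exp (l * (avg A u - u a))) / real (card A))"
  proof -
    have "ennreal (\<Sum>a\<in>A. exp (l * (avg A u - u a))) / ennreal (real (card A))
        = ennreal ((\<Sum>a\<in>A. exp (l * (avg A u - u a))) / real (card A))"
      using assms by (intro divide_ennreal sum_nonneg) (auto simp: card_gt_0_iff)
    then show ?thesis
      by (simp only: nn_integral_pmf_of_set[OF assms(2,1)] sum_ennreal[OF exp_ge_zero]
          ennreal_of_nat_eq_real_of_nat)
  qed
  with Hoeffdings_lemma_nn_integral_0[OF assms(3) mean]
  have "(\<Sum>a\<in>A. exp (l * (avg A u - u a))) / real (card A)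
      \<le> exp (l\<^sup>2 * (spread A u)\<^sup>2 / 8)"
    by (simp add: spread_def)
  then show ?thesis
    using assms by (simp add: divide_le_eq card_gt_0_iff mult.commute)
qed

text \<open>These are the exceptional tuples, each costing one slice. Positive spread is demanded
  because constant weights satisfy the inequality with equality: every tuple would be light, and the
  exponential bound would fail for \<epsilon> > 0.\<close>

definition light_tuples :: "nat \<Rightarrow> nat set \<Rightarrow> (nat \<Rightarrow> real) \<Rightarrow> real \<Rightarrow> (nat \<Rightarrow> nat) set" where
  "light_tuples n A u \<epsilon> = {a \<in> tuples n A.
     spread A u > 0 \<and> (\<Sum>i<n. u (a i)) \<le> real n * (avg A u - \<epsilon> * spread A u)}"

lemma finite_tuples: "finite A \<Longrightarrow> finite (tuples n A)"
  by (rule finite_PiE) auto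

lemma finite_light_tuples: "finite A \<Longrightarrow> finite (light_tuples n A u \<epsilon>)"
  unfolding light_tuples_def by (simp add: finite_tuples)

text \<open>Chernoff's method: each light tuple is counted by an exponential that is at least 1 on
  it, and the exponential moment over all tuples factors over the coordinates.\<close>

lemma card_light_tuples_le:
  assumes "finite A" and "n \<ge> 1" and "\<epsilon> \<ge> 0"
  shows "real (card (light_tuples n A u \<epsilon>)) \<le> real (card A) ^ n * exp (- 2 * real n * \<epsilon>\<^sup>2)"
\<comment> \<open>These cases are separated because a light tuple is what provides a positive
  spread, and \<epsilon> = 0 would make the exponent parameter \<open>l\<close> vanish. Counting all
  tuples suffices when \<epsilon> = 0.\<close>
proof (cases "light_tuples n A u \<epsilon> = {} \<or> \<epsilon> = 0")
  case True
  have "card (light_tuples n A u \<epsilon>) \<le> card (tuples n A)"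
    by (rule card_mono) (auto simp: light_tuples_def assms finite_tuples)
  also have "\<dots> = card A ^ n"
    by (simp add: card_funcsetE)
  finally have "real (card (light_tuples n A u \<epsilon>)) \<le> real (card A) ^ n"
    by (metis of_nat_le_iff of_nat_power)
  with True show ?thesis
    by auto
next
  case False
  define s where "s = spread A u"
  \<comment> \<open>This value minimizes the final exponent
    \<open>- l * n * \<epsilon> * s + n * l\<^sup>2 * s\<^sup>2 / 8\<close>, with minimum
    \<open>- 2 * n * \<epsilon>\<^sup>2\<close>.\<close>
  define l where "l = 4 * \<epsilon> / s"
  from False obtain a0 where "a0 \<in> light_tuples n A u \<epsilon>" by auto
  then have "s > 0" and "A \<noteq> {}"
    using assms(2) by (auto simp: light_tuples_def s_def PiE_iff dest!: bspec[of _ _ 0])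
  then have "l > 0"
    using False assms by (simp add: l_def)
  have "real (card (light_tuples n A u \<epsilon>)) = (\<Sum>a\<in>light_tuples n A u \<epsilon>. 1)"
    by simp
  also have "\<dots> \<le> (\<Sum>a\<in>light_tuples n A u \<epsilon>.
      exp (l * ((\<Sum>i<n. avg A u - u (a i)) - real n * \<epsilon> * s)))"
  proof (rule sum_mono)
    fix a assume "a \<in> light_tuples n A u \<epsilon>"
    then have "(\<Sum>i<n. avg A u - u (a i)) - real n * \<epsilon> * s \<ge> 0"
      by (simp add: light_tuples_def s_def sum_subtractf algebra_simps)
    with \<open>l > 0\<close> show "1 \<le> exp (l * ((\<Sum>i<n. avg A u - u (a i)) - real n * \<epsilon> * s))"
      by simp
  qed
  \<comment> \<open>Enlarging the range to the full product set makes the sum of products an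
    \<open>n\<close>-th power.\<close>
  also have "\<dots> \<le> (\<Sum>a\<in>tuples n A. exp (l * ((\<Sum>i<n. avg A u - u (a i)) - real n * \<epsilon> * s)))"
    by (rule sum_mono2) (auto simp: light_tuples_def assms finite_tuples)
  also have "\<dots> = exp (- l * real n * \<epsilon> * s) *
      (\<Sum>a\<in>tuples n A. \<Prod>i<n. exp (l * (avg A u - u (a i))))"
  proof (subst sum_distrib_left, intro sum.cong refl)
    fix a
    have "exp (l * (D - real n * \<epsilon> * s)) = exp (- l * real n * \<epsilon> * s) * exp (l * D)" for D
      by (simp add: exp_add[symmetric] algebra_simps)
    then show "exp (l * ((\<Sum>i<n. avg A u - u (a i)) - real n * \<epsilon> * s))
        = exp (- l * real n * \<epsilon> * s) * (\<Prod>i<n. exp (l * (avg A u - u (a i))))"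
      by (simp only: exp_sum[OF finite_lessThan, symmetric] sum_distrib_left[symmetric])
  qed
  also have "(\<Sum>a\<in>tuples n A. \<Prod>i<n. exp (l * (avg A u - u (a i))))
      = (\<Sum>a\<in>A. exp (l * (avg A u - u a))) ^ n"
    using assms(1) by (subst prod_sum_PiE[symmetric]) auto
  also have "exp (- l * real n * \<epsilon> * s) * \<dots>
      \<le> exp (- l * real n * \<epsilon> * s) * (real (card A) * exp (l\<^sup>2 * s\<^sup>2 / 8)) ^ n"
    using sum_exp_deviation_le[OF assms(1) \<open>A \<noteq> {}\<close> \<open>l > 0\<close>, of u]
    by (intro mult_left_mono power_mono sum_nonneg) (auto simp: s_def)
  also have "\<dots> = real (card A) ^ n * exp (- l * real n * \<epsilon> * s + real n * (l\<^sup>2 * s\<^sup>2 / 8))"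
    by (simp only: power_mult_distrib exp_add exp_of_nat_mult ac_simps)
  also have "- l * real n * \<epsilon> * s + real n * (l\<^sup>2 * s\<^sup>2 / 8) = - 2 * real n * \<epsilon>\<^sup>2"
    using \<open>s > 0\<close> by (simp add: l_def power2_eq_square field_simps)
  finally show ?thesis .
qed

section \<open>Slice rank bounds from a cover of the support\<close>

text \<open>Slices indexed by arbitrary finite sets are renumbered onto the three consecutive
  integer ranges that \<open>slice_decomposable\<close> prescribes.\<close>

lemma slice_rank_le_card:
  fixes G :: "'x \<Rightarrow> 'y \<Rightarrow> 'z \<Rightarrow> 'a::field"
  assumes fin: "finite P" "finite Q" "finite S"
    and G: "\<And>x y z. x \<in> X \<Longrightarrow> y \<in> Y \<Longrightarrow> z \<in> Z \<Longrightarrow>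
      G x y z = (\<Sum>c\<in>P. f1 c x y * g1 c z) + (\<Sum>b\<in>Q. f2 b x z * g2 b y)
        + (\<Sum>a\<in>S. f3 a y z * g3 a x)"
  shows "slice_rank X Y Z G \<le> card P + card Q + card S"
proof -
  obtain e1 where e1: "bij_betw e1 {1..card P} P"
    using ex_bij_betw_nat_finite_1[OF fin(1)] by blast
  obtain e2 where e2: "bij_betw e2 {card P+1..card P + card Q} Q"
    using finite_same_card_bij[of "{card P+1..card P + card Q}" Q] fin(2) by auto
  obtain e3 where e3: "bij_betw e3 {card P + card Q+1..card P + card Q + card S} S"
    using finite_same_card_bij[of "{card P + card Q+1..card P + card Q + card S}" S] fin(3) by auto
  have "slice_decomposable X Y Z G (card P + card Q + card S)"
    unfolding slice_decomposable_def
  proof (intro exI conjI ballI)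
    fix x y z assume "x \<in> X" "y \<in> Y" "z \<in> Z"
    then show "G x y z = (\<Sum>i\<in>{1..card P}. f1 (e1 i) x y * g1 (e1 i) z)
        + (\<Sum>i\<in>{card P+1..card P + card Q}. f2 (e2 i) x z * g2 (e2 i) y)
        + (\<Sum>i\<in>{card P + card Q+1..card P + card Q + card S}. f3 (e3 i) y z * g3 (e3 i) x)"
      using G sum.reindex_bij_betw[OF e1, of "\<lambda>c. f1 c x y * g1 c z"]
        sum.reindex_bij_betw[OF e2, of "\<lambda>b. f2 b x z * g2 b y"]
        sum.reindex_bij_betw[OF e3, of "\<lambda>a. f3 a y z * g3 a x"] by simp
  qed auto
  then show ?thesis
    unfolding slice_rank_def by (rule Least_le)
qed

lemma sum_split_off:
  fixes \<phi> :: "'s \<Rightarrow> 'a::comm_monoid_add"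
  assumes "finite T" and "S \<subseteq> T"
  shows "(\<Sum>t\<in>T. \<phi> t) = (\<Sum>t\<in>S. \<phi> t) + (\<Sum>t\<in>T - S. \<phi> t)"
  using sum.subset_diff[OF assms(2,1), of \<phi>] by (simp add: add.commute)

text \<open>The support of \<open>R\<close> is split into three disjoint groups: a in
  \<open>SA\<close>; otherwise b in \<open>SB\<close>; otherwise c in \<open>SC\<close>. Within each
  group the terms sharing the distinguished index add up to one slice.\<close>

lemma slice_rank_le_of_cover:
  fixes G :: "'x \<Rightarrow> 'y \<Rightarrow> 'z \<Rightarrow> 'a::field"
  assumes fin: "finite I" "finite J" "finite K"
    and sub: "SA \<subseteq> I" "SB \<subseteq> J" "SC \<subseteq> K"
    and G: "\<And>x y z. x \<in> X \<Longrightarrow> y \<in> Y \<Longrightarrow> z \<in> Z \<Longrightarrow>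
      G x y z = (\<Sum>a\<in>I. \<Sum>b\<in>J. \<Sum>c\<in>K. R a b c * f a x * g b y * h c z)"
    and cover: "\<And>a b c. a \<in> I \<Longrightarrow> b \<in> J \<Longrightarrow> c \<in> K \<Longrightarrow> R a b c \<noteq> 0 \<Longrightarrow>
      a \<in> SA \<or> b \<in> SB \<or> c \<in> SC"
  shows "slice_rank X Y Z G \<le> card SC + card SB + card SA"
proof -
  have finS: "finite SC" "finite SB" "finite SA"
    using fin sub finite_subset by blast+
  show ?thesis
  proof (rule slice_rank_le_card[OF finS])
    fix x y z assume xyz: "x \<in> X" "y \<in> Y" "z \<in> Z"
    define \<tau> where "\<tau> = (\<lambda>a b c. R a b c * f a x * g b y * h c z)"
    have "G x y z = (\<Sum>a\<in>I. \<Sum>b\<in>J. \<Sum>c\<in>K. \<tau> a b c)"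
      using G xyz by (simp add: \<tau>_def)
    also have "\<dots> = (\<Sum>a\<in>SA. \<Sum>b\<in>J. \<Sum>c\<in>K. \<tau> a b c) + (\<Sum>a\<in>I-SA. \<Sum>b\<in>J. \<Sum>c\<in>K. \<tau> a b c)"
      by (rule sum_split_off) fact+
    also have "(\<Sum>a\<in>I-SA. \<Sum>b\<in>J. \<Sum>c\<in>K. \<tau> a b c)
        = (\<Sum>a\<in>I-SA. \<Sum>b\<in>SB. \<Sum>c\<in>K. \<tau> a b c) + (\<Sum>a\<in>I-SA. \<Sum>b\<in>J-SB. \<Sum>c\<in>K. \<tau> a b c)"
      by (subst sum_split_off[OF fin(2) sub(2)]) (simp add: sum.distrib)
    \<comment> \<open>With a outside \<open>SA\<close> and b outside \<open>SB\<close>,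
      \<open>cover\<close> leaves only zero coefficients for c outside \<open>SC\<close>.\<close>
    also have "(\<Sum>a\<in>I-SA. \<Sum>b\<in>J-SB. \<Sum>c\<in>K. \<tau> a b c) = (\<Sum>a\<in>I-SA. \<Sum>b\<in>J-SB. \<Sum>c\<in>SC. \<tau> a b c)"
      by (intro sum.cong sum.mono_neutral_right fin sub) (use cover in \<open>auto simp: \<tau>_def\<close>)
    also have "\<dots> = (\<Sum>c\<in>SC. \<Sum>a\<in>I-SA. \<Sum>b\<in>J-SB. \<tau> a b c)"
      by (subst sum.swap[of _ SC], subst sum.swap[of _ SC]) simp
    also have "(\<Sum>a\<in>I-SA. \<Sum>b\<in>SB. \<Sum>c\<in>K. \<tau> a b c) = (\<Sum>b\<in>SB. \<Sum>a\<in>I-SA. \<Sum>c\<in>K. \<tau> a b c)"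
      by (rule sum.swap)
    finally show "G x y z
      = (\<Sum>c\<in>SC. (\<Sum>a\<in>I-SA. \<Sum>b\<in>J-SB. R a b c * f a x * g b y) * h c z)
      + (\<Sum>b\<in>SB. (\<Sum>a\<in>I-SA. \<Sum>c\<in>K. R a b c * f a x * h c z) * g b y)
      + (\<Sum>a\<in>SA. (\<Sum>b\<in>J. \<Sum>c\<in>K. R a b c * g b y * h c z) * f a x)"
      unfolding \<tau>_def sum_distrib_right by (simp only: ac_simps)
  qed
qed

section \<open>Low total weight forces a light tuple\<close>

text \<open>Summing the coordinatewise bounds compares the total weight with the sum of the three
  separate thresholds, which three tuples that are not light would exceed.\<close>

lemma light_tuples_cover:
  assumes fin: "finite A" "finite B" "finite C"
    and pos: "spread A u + spread B v + spread C w > 0"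
    and n: "n \<ge> 1"
    and mem: "a \<in> tuples n A" "b \<in> tuples n B" "c \<in> tuples n C"
    and le: "\<And>i. i < n \<Longrightarrow> u (a i) + v (b i) + w (c i)
      \<le> avg A u + avg B v + avg C w - \<epsilon> * (spread A u + spread B v + spread C w)"
  shows "a \<in> light_tuples n A u \<epsilon> \<or> b \<in> light_tuples n B v \<epsilon> \<or> c \<in> light_tuples n C w \<epsilon>"
proof (rule ccontr)
  \<comment> \<open>Constant weights attain the bound with equality, so the contradiction has to come from
    a coordinate with positive spread.\<close>
  have *: "real n * (avg A u - \<epsilon> * spread A u) \<le> (\<Sum>i<n. u (a i))
      \<and> (spread A u > 0 \<longrightarrow> real n * (avg A u - \<epsilon> * spread A u) < (\<Sum>i<n. u (a i)))
      \<and> spread A u \<ge> 0"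
    if "finite A" "a \<in> tuples n A" "a \<notin> light_tuples n A u \<epsilon>" for A u a
  proof -
    have "a 0 \<in> A"
      using that n by (auto simp: PiE_iff)
    then have nonneg: "spread A u \<ge> 0"
      using that by (intro spread_nonneg) auto
    show ?thesis
    proof (cases "spread A u = 0")
      case True
      then have "(\<Sum>i<n. u (a i)) = (\<Sum>i<n. avg A u)"
        using that by (intro sum.cong refl spread_zero_imp_eq_avg) (auto simp: PiE_iff)
      with True show ?thesis by simp
    next
      case False
      with that nonneg show ?thesis by (auto simp: light_tuples_def)
    qed
  qed
  assume "\<not> (a \<in> light_tuples n A u \<epsilon> \<or> b \<in> light_tuples n B v \<epsilon> \<or> c \<in> light_tuples n C w \<epsilon>)"
  then have A: "a \<notin> light_tuples n A u \<epsilon>" and B: "b \<notin> light_tuples n B v \<epsilon>"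
    and C: "c \<notin> light_tuples n C w \<epsilon>"
    by auto
  have "real n * (avg A u - \<epsilon> * spread A u) + real n * (avg B v - \<epsilon> * spread B v)
      + real n * (avg C w - \<epsilon> * spread C w) < (\<Sum>i<n. u (a i)) + (\<Sum>i<n. v (b i)) + (\<Sum>i<n. w (c i))"
    using *[OF fin(1) mem(1) A] *[OF fin(2) mem(2) B] *[OF fin(3) mem(3) C] pos by linarith
  moreover have "(\<Sum>i<n. u (a i)) + (\<Sum>i<n. v (b i)) + (\<Sum>i<n. w (c i))
      \<le> real n * (avg A u + avg B v + avg C w - \<epsilon> * (spread A u + spread B v + spread C w))"
    using sum_mono[of "{..<n}" "\<lambda>i. u (a i) + v (b i) + w (c i)", OF le]
    by (simp add: sum.distrib)
  ultimately show False
    by (simp add: algebra_simps)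
qed

section \<open>Expansion of the tensor power in product bases\<close>

text \<open>Moving the weight condition into the summand gives a sum over a full box, the shape to
  which distributivity over products applies.\<close>

lemma sum_triples_filter:
  fixes \<phi> :: "nat \<Rightarrow> nat \<Rightarrow> nat \<Rightarrow> 'a::comm_monoid_add"
  assumes "finite A" "finite B" "finite C"
  shows "(\<Sum>(a, b, c)\<in>{(a, b, c) \<in> A \<times> B \<times> C. p a b c}. \<phi> a b c)
    = (\<Sum>a\<in>A. \<Sum>b\<in>B. \<Sum>c\<in>C. if p a b c then \<phi> a b c else 0)"
proof -
  have "{(a, b, c) \<in> A \<times> B \<times> C. p a b c} = {t \<in> A \<times> B \<times> C. case t of (a, b, c) \<Rightarrow> p a b c}"
    by auto
  then have "(\<Sum>(a, b, c)\<in>{(a, b, c) \<in> A \<times> B \<times> C. p a b c}. \<phi> a b c)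
      = (\<Sum>(a, b, c)\<in>A \<times> B \<times> C. if p a b c then \<phi> a b c else 0)"
    using assms by (auto simp: sum.inter_filter intro!: sum.cong)
  then show ?thesis
    by (simp add: sum.cartesian_product case_prod_unfold)
qed

text \<open>Multiplying out a product of \<open>n\<close> sums gives one term per choice function,
  and these choice functions are exactly the index tuples; this is done for each of the three sums
  in turn.\<close>

lemma tensor_power_expansion:
  fixes F :: "'x \<Rightarrow> 'y \<Rightarrow> 'z \<Rightarrow> 'a::field" and f :: "nat \<Rightarrow> 'x \<Rightarrow> 'a"
  assumes fin: "finite A" "finite B" "finite C"
    and F: "\<And>x y z. x \<in> X \<Longrightarrow> y \<in> Y \<Longrightarrow> z \<in> Z \<Longrightarrow>
      F x y z = (\<Sum>a\<in>A. \<Sum>b\<in>B. \<Sum>c\<in>C. r a b c * f a x * g b y * h c z)"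
    and mem: "x \<in> tuples n X" "y \<in> tuples n Y" "z \<in> tuples n Z"
  shows "tensor_power n F x y z = (\<Sum>a\<in>tuples n A. \<Sum>b\<in>tuples n B. \<Sum>c\<in>tuples n C.
      (\<Prod>i<n. r (a i) (b i) (c i)) * (\<Prod>i<n. f (a i) (x i)) * (\<Prod>i<n. g (b i) (y i))
        * (\<Prod>i<n. h (c i) (z i)))"
proof -
  have "tensor_power n F x y z = (\<Prod>i<n. \<Sum>a\<in>A. \<Sum>b\<in>B. \<Sum>c\<in>C.
      r a b c * f a (x i) * g b (y i) * h c (z i))"
    unfolding tensor_power_def using F mem by (intro prod.cong) (auto simp: PiE_iff)
  also have "\<dots> = (\<Sum>a\<in>tuples n A. \<Sum>b\<in>tuples n B. \<Sum>c\<in>tuples n C. \<Prod>i<n.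
      r (a i) (b i) (c i) * f (a i) (x i) * g (b i) (y i) * h (c i) (z i))"
    using fin by (simp add: prod_sum_PiE)
  finally show ?thesis
    by (simp add: prod.distrib)
qed

section \<open>The bound for a single witness\<close>

lemma slice_rank_tensor_power_le:
  fixes F :: "'x \<Rightarrow> 'y \<Rightarrow> 'z \<Rightarrow> 'a::field"
  assumes fin: "finite X" "finite Y" "finite Z" and n: "n \<ge> 1" and "\<epsilon> \<ge> 0"
    and "instability_witness X Y Z F \<epsilon>"
  shows "real (slice_rank (tuples n X) (tuples n Y) (tuples n Z) (tensor_power n F))
    \<le> (real (card X) ^ n + real (card Y) ^ n + real (card Z) ^ n) * exp (- 2 * real n * \<epsilon>\<^sup>2)"
proof -
  obtain A B C and f :: "nat \<Rightarrow> 'x \<Rightarrow> 'a" and g :: "nat \<Rightarrow> 'y \<Rightarrow> 'a" and h :: "nat \<Rightarrow> 'z \<Rightarrow> 'a"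
    and u v w r where basis: "fun_basis X A f" "fun_basis Y B g" "fun_basis Z C h"
    and pos: "spread A u + spread B v + spread C w > 0"
    and F: "\<forall>x\<in>X. \<forall>y\<in>Y. \<forall>z\<in>Z. F x y z = (\<Sum>(a, b, c) \<in> {(a, b, c) \<in> A \<times> B \<times> C.
        u a + v b + w c \<le> (avg A u + avg B v + avg C w)
          - \<epsilon> * (spread A u + spread B v + spread C w)}. r a b c * f a x * g b y * h c z)"
    using assms(6) unfolding instability_witness_def by blast
  define p where "p = (\<lambda>a b c. u a + v b + w c \<le> (avg A u + avg B v + avg C w)
      - \<epsilon> * (spread A u + spread B v + spread C w))"
  \<comment> \<open>Extension by zero lets the coefficients themselves record the weight condition:
    a nonzero product of them forces \<open>p\<close> in every coordinate.\<close>
  define r' where "r' = (\<lambda>a b c. if p a b c then r a b c else 0)"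
  note finA = fun_basis_finite_card_le[OF fin(1) basis(1)]
  note finB = fun_basis_finite_card_le[OF fin(2) basis(2)]
  note finC = fun_basis_finite_card_le[OF fin(3) basis(3)]
  have F': "F x y z = (\<Sum>a\<in>A. \<Sum>b\<in>B. \<Sum>c\<in>C. r' a b c * f a x * g b y * h c z)"
    if "x \<in> X" "y \<in> Y" "z \<in> Z" for x y z
  proof -
    have "F x y z = (\<Sum>(a, b, c)\<in>{(a, b, c) \<in> A \<times> B \<times> C. p a b c}.
        r a b c * f a x * g b y * h c z)"
      unfolding p_def using F that by blast
    also note sum_triples_filter[OF finA(1) finB(1) finC(1)]
    finally show ?thesis
      by (auto simp: r'_def intro!: sum.cong)
  qed
  let ?SA = "light_tuples n A u \<epsilon>" and ?SB = "light_tuples n B v \<epsilon>"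
    and ?SC = "light_tuples n C w \<epsilon>"
  have "slice_rank (tuples n X) (tuples n Y) (tuples n Z) (tensor_power n F)
      \<le> card ?SC + card ?SB + card ?SA"
  proof (rule slice_rank_le_of_cover[where I = "tuples n A" and J = "tuples n B"
        and K = "tuples n C"])
    fix a b c
    assume mem: "a \<in> tuples n A" "b \<in> tuples n B" "c \<in> tuples n C"
      and "(\<Prod>i<n. r' (a i) (b i) (c i)) \<noteq> 0"
    then have "p (a i) (b i) (c i)" if "i < n" for i
      using that by (auto simp: r'_def split: if_splits)
    then show "a \<in> ?SA \<or> b \<in> ?SB \<or> c \<in> ?SC"
      by (intro light_tuples_cover[OF finA(1) finB(1) finC(1) pos n mem]) (simp add: p_def)
  qed (use finA finB finC in \<open>auto simp: finite_tuples light_tuples_def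
      intro: tensor_power_expansion[OF _ _ _ F']\<close>)
  then have "real (slice_rank (tuples n X) (tuples n Y) (tuples n Z) (tensor_power n F))
      \<le> real (card ?SA) + real (card ?SB) + real (card ?SC)"
    by linarith
  also have "\<dots> \<le> real (card A) ^ n * exp (- 2 * real n * \<epsilon>\<^sup>2)
      + real (card B) ^ n * exp (- 2 * real n * \<epsilon>\<^sup>2) + real (card C) ^ n * exp (- 2 * real n * \<epsilon>\<^sup>2)"
    using finA finB finC n \<open>\<epsilon> \<ge> 0\<close> by (intro add_mono card_light_tuples_le) auto
  \<comment> \<open>Index sets of bases are no larger than the underlying sets.\<close>
  also have "\<dots> \<le> real (card X) ^ n * exp (- 2 * real n * \<epsilon>\<^sup>2)
      + real (card Y) ^ n * exp (- 2 * real n * \<epsilon>\<^sup>2) + real (card Z) ^ n * exp (- 2 * real n * \<epsilon>\<^sup>2)"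
    using finA finB finC by (intro add_mono mult_right_mono power_mono) auto
  finally show ?thesis
    by (simp add: algebra_simps)
qed

section \<open>Degenerate cases and passage to the supremum\<close>

text \<open>This keeps the instability away from -\<infinity>, whose square is \<infinity> and would
  make the right-hand side of the final bound zero. Trivial weights always equal their means, so no
  triple could satisfy the strict inequality, yet a nonzero value of \<open>F\<close> needs
  one.\<close>

lemma unstable_imp_instability_witness_0:
  fixes F :: "'x \<Rightarrow> 'y \<Rightarrow> 'z \<Rightarrow> 'a::field"
  assumes fin: "finite X" "finite Y" "finite Z" and "unstable X Y Z F"
    and nz: "x0 \<in> X" "y0 \<in> Y" "z0 \<in> Z" "F x0 y0 z0 \<noteq> 0"
  shows "instability_witness X Y Z F 0"
proof -
  obtain A B C and f :: "nat \<Rightarrow> 'x \<Rightarrow> 'a" and g :: "nat \<Rightarrow> 'y \<Rightarrow> 'a" and h :: "nat \<Rightarrow> 'z \<Rightarrow> 'a"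
    and u v w r where basis: "fun_basis X A f" "fun_basis Y B g" "fun_basis Z C h"
    and F: "\<forall>x\<in>X. \<forall>y\<in>Y. \<forall>z\<in>Z. F x y z = (\<Sum>(a, b, c) \<in> {(a, b, c) \<in> A \<times> B \<times> C.
        u a + v b + w c < avg A u + avg B v + avg C w}. r a b c * f a x * g b y * h c z)"
    using assms(4) unfolding unstable_def by blast
  let ?lt = "\<lambda>a b c. u a + v b + w c < avg A u + avg B v + avg C w"
  note finA = fun_basis_finite_card_le(1)[OF fin(1) basis(1)]
  note finB = fun_basis_finite_card_le(1)[OF fin(2) basis(2)]
  note finC = fun_basis_finite_card_le(1)[OF fin(3) basis(3)]
  have "{(a, b, c) \<in> A \<times> B \<times> C. ?lt a b c} \<noteq> {}"
    using F nz by (metis (no_types, lifting) sum.empty)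
  then obtain a b c where abc: "a \<in> A" "b \<in> B" "c \<in> C" "?lt a b c"
    by auto
  have nonneg: "spread A u \<ge> 0" "spread B v \<ge> 0" "spread C w \<ge> 0"
    using abc finA finB finC by (auto intro!: spread_nonneg)
  have "spread A u + spread B v + spread C w \<noteq> 0"
  proof
    assume "spread A u + spread B v + spread C w = 0"
    with nonneg have "spread A u = 0" "spread B v = 0" "spread C w = 0"
      by linarith+
    with abc finA finB finC have "u a = avg A u" "v b = avg B v" "w c = avg C w"
      by (simp_all add: spread_zero_imp_eq_avg)
    with abc(4) show False by simp
  qed
  with nonneg have pos: "spread A u + spread B v + spread C w > 0"
    by linarith
  \<comment> \<open>The weak inequality admits additional triples, those with equality; they receive
    coefficient zero.\<close>
  define r' where "r' = (\<lambda>a b c. if ?lt a b c then r a b c else 0)"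
  have "F x y z = (\<Sum>(a, b, c) \<in> {(a, b, c) \<in> A \<times> B \<times> C.
      u a + v b + w c \<le> (avg A u + avg B v + avg C w)
        - 0 * (spread A u + spread B v + spread C w)}. r' a b c * f a x * g b y * h c z)"
    if "x \<in> X" "y \<in> Y" "z \<in> Z" for x y z
  proof -
    have "F x y z = (\<Sum>(a, b, c)\<in>{(a, b, c) \<in> A \<times> B \<times> C. ?lt a b c}.
        r a b c * f a x * g b y * h c z)"
      using F that by blast
    then show ?thesis
      unfolding sum_triples_filter[OF finA finB finC]
      by (auto simp: r'_def intro!: sum.cong)
  qed
  with basis pos show ?thesis
    unfolding instability_witness_def by blast
qed

lemma slice_rank_eq_0:
  assumes "\<And>x y z. x \<in> X \<Longrightarrow> y \<in> Y \<Longrightarrow> z \<in> Z \<Longrightarrow> G x y z = 0"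
  shows "slice_rank X Y Z G = 0"
  using slice_rank_le_card[of "{}" "{}" "{}" X Y Z G] assms by simp

text \<open>A finite supremum inherits the bound by continuity. An infinite one is impossible, since
  the bound would tend to zero while \<open>N\<close> is positive.\<close>

lemma le_exp_ereal_Sup:
  fixes S :: "real set"
  assumes bound: "\<And>\<epsilon>. \<epsilon> \<in> S \<Longrightarrow> N \<le> K * exp (- 2 * real n * \<epsilon>\<^sup>2)"
    and "S \<noteq> {}" and "N > 0" and "n \<ge> 1" and "K \<ge> 0"
  shows "ereal N \<le> ereal K * exp_ereal (- (2 * ereal (real n) * (Sup (ereal ` S))\<^sup>2))"
proof (cases "Sup (ereal ` S)")
  case (real s)
  have "\<epsilon> \<le> s" if "\<epsilon> \<in> S" for \<epsilon>
    using Sup_upper[of "ereal \<epsilon>" "ereal ` S"] that real by simp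
  then have "bdd_above S"
    by (rule bdd_aboveI)
  have "ereal (Sup S) = Sup (ereal ` S)"
    using real by (intro ereal_Sup) auto
  then have "Sup S = s"
    using real by simp
  with closure_contains_Sup[OF \<open>S \<noteq> {}\<close> \<open>bdd_above S\<close>] have "s \<in> closure S"
    by simp
  \<comment> \<open>The supremum need not be attained, but it lies in the closure of
    \<open>S\<close>, and the bound defines a closed set.\<close>
  moreover have "closed {t. N \<le> K * exp (- 2 * real n * t\<^sup>2)}"
    by (intro closed_Collect_le continuous_intros)
  then have "closure S \<subseteq> {t. N \<le> K * exp (- 2 * real n * t\<^sup>2)}"
    using bound by (intro closure_minimal) auto
  ultimately have "N \<le> K * exp (- 2 * real n * s\<^sup>2)"
    by auto
  moreover have "- (2 * ereal (real n) * (ereal s)\<^sup>2) = ereal (- 2 * real n * s\<^sup>2)"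
    by (metis ereal_power mult_minus_left numeral_eq_ereal times_ereal.simps(1)
        uminus_ereal.simps(1))
  ultimately show ?thesis
    using real by (simp add: exp_ereal_def)
next
  case PInf
  \<comment> \<open>Beyond 1, \<epsilon> is at most \<open>2 * n * \<epsilon>\<^sup>2\<close>, so
    the bound gives \<open>N * exp \<epsilon> \<le> K\<close>; beyond \<open>K / N\<close>, this
    contradicts \<open>exp \<epsilon> \<ge> \<epsilon>\<close>.\<close>
  define m where "m = max 1 (K / N)"
  from PInf have "ereal m < Sup (ereal ` S)"
    by simp
  then obtain \<epsilon> where "\<epsilon> \<in> S" "\<epsilon> > m"
    unfolding less_Sup_iff by auto
  then have "\<epsilon> > 1" "\<epsilon> > K / N"
    by (simp_all add: m_def)
  have "1 * (1 * \<epsilon>) \<le> (2 * real n) * (\<epsilon> * \<epsilon>)"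
    using \<open>\<epsilon> > 1\<close> \<open>n \<ge> 1\<close> by (intro mult_mono) auto
  then have "\<epsilon> \<le> 2 * real n * \<epsilon>\<^sup>2"
    by (simp add: power2_eq_square)
  then have "N \<le> K * exp (- \<epsilon>)"
    using bound[OF \<open>\<epsilon> \<in> S\<close>] \<open>K \<ge> 0\<close>
    by (smt (verit) exp_le_cancel_iff mult_left_mono mult_minus_left)
  then have "N * exp \<epsilon> \<le> K"
    by (simp add: exp_minus field_simps)
  moreover have "K < N * \<epsilon>"
    using \<open>\<epsilon> > K / N\<close> \<open>N > 0\<close> by (simp add: field_simps)
  moreover have "N * \<epsilon> \<le> N * exp \<epsilon>"
    using \<open>N > 0\<close> exp_ge_add_one_self[of \<epsilon>] by (intro mult_left_mono) linarith+
  ultimately show ?thesis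
    by linarith
next
  case MInf
  with \<open>S \<noteq> {}\<close> show ?thesis
    by (auto simp: Sup_eq_MInfty)
qed

theorem theorem4p10:
  fixes F :: "'x \<Rightarrow> 'y \<Rightarrow> 'z \<Rightarrow> 'a::field"
    and X :: "'x set" and Y :: "'y set" and Z :: "'z set"
    and n :: nat
  assumes "finite X" and "finite Y" and "finite Z"
    and "unstable X Y Z F"
    and "n \<ge> 1"
  shows "ereal (real (slice_rank (tuples n X) (tuples n Y) (tuples n Z) (tensor_power n F)))
    \<le> ereal (real (card X) ^ n + real (card Y) ^ n + real (card Z) ^ n)
      * exp_ereal (- (2 * ereal (real n) * (instability X Y Z F)\<^sup>2))"
\<comment> \<open>Slice rank zero is settled by nonnegativity of the right-hand side. This absorbs
  the case of \<open>F\<close> vanishing on the whole product, where the instability may be infinite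
  of either sign.\<close>
proof (cases "slice_rank (tuples n X) (tuples n Y) (tuples n Z) (tensor_power n F) = 0")
  case True
  have "exp_ereal t \<ge> 0" for t
    by (cases t) (auto simp: exp_ereal_def)
  with True show ?thesis
    by (simp add: zero_ereal_def[symmetric])
next
  case False
  define S where "S = {\<epsilon>. \<epsilon> \<ge> 0 \<and> instability_witness X Y Z F \<epsilon>}"
  have "\<exists>x\<in>X. \<exists>y\<in>Y. \<exists>z\<in>Z. F x y z \<noteq> 0"
  proof (rule ccontr)
    assume F0: "\<not> ?thesis"
    have "tensor_power n F x y z = 0"
      if "x \<in> tuples n X" "y \<in> tuples n Y" "z \<in> tuples n Z" for x y z
    proof -
      \<comment> \<open>Since \<open>n \<ge> 1\<close>, coordinate 0 exists and contributes a zero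
        factor.\<close>
      have "F (x 0) (y 0) (z 0) = 0"
        using F0 that \<open>n \<ge> 1\<close> by (auto simp: PiE_iff)
      with \<open>n \<ge> 1\<close> show ?thesis
        by (auto simp: tensor_power_def intro!: bexI[of _ 0])
    qed
    with False show False
      by (simp add: slice_rank_eq_0)
  qed
  then have "S \<noteq> {}"
    using unstable_imp_instability_witness_0[OF assms(1-4)] by (auto simp: S_def)
  have "instability X Y Z F = Sup (ereal ` S)"
    unfolding instability_def S_def by (rule arg_cong[of _ _ Sup]) auto
  moreover have "real (slice_rank (tuples n X) (tuples n Y) (tuples n Z) (tensor_power n F))
      \<le> (real (card X) ^ n + real (card Y) ^ n + real (card Z) ^ n) * exp (- 2 * real n * \<epsilon>\<^sup>2)"
    if "\<epsilon> \<in> S" for \<epsilon>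
    using that assms by (intro slice_rank_tensor_power_le) (auto simp: S_def)
  ultimately show ?thesis
    using le_exp_ereal_Sup[of S] \<open>S \<noteq> {}\<close> False \<open>n \<ge> 1\<close> by simp
qed

end
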